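(* Let $\gamma\in[4/3,2]$ and let $x\in\mathrm{B}_+^{\Omega}\setminus\mathrm{OT}_+^{\Omega}$. Then, along the orbit of $x$ under the flow for this $\gamma$, $$\lim_{\tau\to-\infty}M(\tau)P(\tau)\sin(\theta(\tau))=0\qquad\text{and}\qquad\lim_{\tau\to\infty}\Omega(\tau)=0.$$
   Context: For a parameter $\gamma\in(2/3,2]$ (fluid with equation of state $p=(\gamma-1)\rho$) put $q^*=\tfrac12(3\gamma-2)$ and consider the autonomous system for $(M,P,\theta,\Sigma_+,\Sigma_-)\in\mathbb{R}^5$ (expansion-normalized Einstein equations for Bianchi type VI$_{-1/9}$ with an orthogonal perfect fluid), with $'=d/d\tau$: $$M'=[q+2\Sigma_++2\sqrt3\cos(\theta)\Sigma_-]M,$$ $$P'=[-(2-q)-(3+\sin^2\theta)\Sigma_++\sqrt3\cos(\theta)\Sigma_-]P,$$ $$\theta'=-2\sqrt3\,\Sigma_-\sin\theta,$$ $$\Sigma_+'=-(2-q)\Sigma_+-2M^2+3P^2,$$ $$\Sigma_-'=-(2-q)\Sigma_--\sqrt3\cos(\theta)\big(2M^2+P^2-\tfrac23\sin^2(\theta)\Sigma_+^2\big),$$ where $$q=(2-q^* )\big((1+\tfrac13\sin^2\theta)\Sigma_+^2+\Sigma_-^2+P^2\big)+q^*\big(1-(1+\tfrac13\sin^2\theta)M^2\big).$$ Put $\Omega=1-(1+\tfrac13\sin^2\theta)(M^2+\Sigma_+^2)-P^2-\Sigma_-^2$; along solutions $\Omega'=2(q-q^* )\Omega$. Phase space: $\mathrm{B}_+=\{(M,P,\theta,\Sigma_+,\Sigma_-)\in\mathbb{R}^5: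 M>0,\ P\ge0,\ \theta\in(0,\pi),\ \Omega\ge0\}$; $\mathrm{B}_+^{\Omega}=\mathrm{B}_+\cap\{\Omega>0\}$; $\mathrm{OT}_+^{\Omega}=\mathrm{B}_+^{\Omega}\cap\{P=0\}$. All are invariant under the (complete) flow $\varphi^\tau$ of the system. For initial data $x$, $M(\tau),P(\tau),\theta(\tau),\Omega(\tau)$ denote the values of these functions at $\varphi^\tau(x)$. *)

theory Defs
  imports "HOL-Analysis.Analysis"
begin

text \<open>A state is a tuple \<open>(M, P, \<theta>, \<Sigma>\<^sub>+, \<Sigma>\<^sub>-)\<close>; the shear variables are called
  \<open>Sp\<close> and \<open>Sm\<close> below.\<close>

type_synonym state = "real \<times> real \<times> real \<times> real \<times> real"

definition qstar :: "real \<Rightarrow> real" where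
  "qstar \<gamma> = (3 * \<gamma> - 2) / 2"

definition decel :: "real \<Rightarrow> state \<Rightarrow> real" where
  "decel \<gamma> = (\<lambda>(M, P, \<theta>, Sp, Sm).
     (2 - qstar \<gamma>) * ((1 + (sin \<theta>)\<^sup>2 / 3) * Sp\<^sup>2 + Sm\<^sup>2 + P\<^sup>2)
     + qstar \<gamma> * (1 - (1 + (sin \<theta>)\<^sup>2 / 3) * M\<^sup>2))"

definition vector_field :: "real \<Rightarrow> state \<Rightarrow> state" where
  "vector_field \<gamma> = (\<lambda>(M, P, \<theta>, Sp, Sm).
     let q = decel \<gamma> (M, P, \<theta>, Sp, Sm) in
       ((q + 2 * Sp + 2 * sqrt 3 * cos \<theta> * Sm) * M,
        (- (2 - q) - (3 + (sin \<theta>)\<^sup>2) * Sp + sqrt 3 * cos \<theta> * Sm) * P,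
        - 2 * sqrt 3 * Sm * sin \<theta>,
        - (2 - q) * Sp - 2 * M\<^sup>2 + 3 * P\<^sup>2,
        - (2 - q) * Sm - sqrt 3 * cos \<theta> * (2 * M\<^sup>2 + P\<^sup>2 - 2 / 3 * (sin \<theta>)\<^sup>2 * Sp\<^sup>2)))"

definition M_of :: "state \<Rightarrow> real" where
  "M_of = (\<lambda>(M, P, \<theta>, Sp, Sm). M)"

definition P_of :: "state \<Rightarrow> real" where
  "P_of = (\<lambda>(M, P, \<theta>, Sp, Sm). P)"

definition theta_of :: "state \<Rightarrow> real" where
  "theta_of = (\<lambda>(M, P, \<theta>, Sp, Sm). \<theta>)"

definition Omega :: "state \<Rightarrow> real" where
  "Omega = (\<lambda>(M, P, \<theta>, Sp, Sm).
     1 - (1 + (sin \<theta>)\<^sup>2 / 3) * (M\<^sup>2 + Sp\<^sup>2) - P\<^sup>2 - Sm\<^sup>2)"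

definition B_plus :: "state set" where
  "B_plus = {x. M_of x > 0 \<and> P_of x \<ge> 0 \<and> theta_of x \<in> {0<..<pi} \<and> Omega x \<ge> 0}"

definition B_plus_Omega :: "state set" where
  "B_plus_Omega = B_plus \<inter> {x. Omega x > 0}"

definition OT_plus_Omega :: "state set" where
  "OT_plus_Omega = B_plus_Omega \<inter> {x. P_of x = 0}"

text \<open>The flow line \<open>\<tau> \<mapsto> \<phi>\<^sup>\<tau>(x)\<close>, as the solution on all of \<open>\<real>\<close> with initial value \<open>x\<close> at
  \<open>\<tau> = 0\<close>. The vector field is smooth, so there is at most one; for \<open>x\<close> in \<^const>\<open>B_plus\<close> there
  is one because the flow is complete there. Invariance of the phase space is not part of the
  definition.\<close>

definition flow_line :: "real \<Rightarrow> state \<Rightarrow> (real \<Rightarrow> state) \<Rightarrow> bool" where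
  "flow_line \<gamma> x X \<longleftrightarrow>
     X 0 = x \<and> (\<forall>\<tau>. (X has_vector_derivative vector_field \<gamma> (X \<tau>)) (at \<tau>))"

end

theory Submission
  imports Defs
begin

text \<open>The idea is that \<open>Z = \<Omega>\<^sup>3 / (M\<^sup>4 P\<^sup>2 sin\<^sup>5 \<theta>)\<close> is strictly decreasing: these exponents
  cancel \<open>q\<close>, \<open>\<Sigma>\<^sub>-\<close> and all of the \<open>\<Sigma>\<^sub>+\<close>-terms except one, leaving
  \<open>(ln Z)' = 4 - 6 q\<^sup>* - 2 cos\<^sup>2\<theta> \<Sigma>\<^sub>+\<close>. Since \<open>\<bar>\<Sigma>\<^sub>+\<bar> \<le> 1\<close>, and \<open>q\<^sup>* \<ge> 1\<close> exactly when
  \<open>\<gamma> \<ge> 4/3\<close>, this is at most \<open>-2 sin\<^sup>2\<theta>\<close>. In each time direction either \<open>ln Z\<close> is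
  unbounded or \<open>sin\<^sup>2\<theta>\<close> is integrable with bounded derivative and hence tends to \<open>0\<close>. As the
  variables are bounded by \<open>1\<close>, either alternative gives both limits.\<close>

section \<open>Tools from real analysis: linear equations, dissipation, roots of null
  functions\<close>

lemma linear_ode_pos:
  fixes y f :: "real \<Rightarrow> real"
  assumes deriv: "\<And>t. (y has_real_derivative f t * y t) (at t)"
    and cont: "continuous_on UNIV f"
    and "y 0 > 0"
  shows "y t > 0"
proof -
  \<comment> \<open>Either sign of \<open>t\<close> is allowed, so the argument runs on the segment
    between \<open>0\<close> and \<open>t\<close>. It is compact, and there the continuous
    \<open>f\<close> has an antiderivative \<open>G\<close>.\<close>
  define S where "S = {min 0 t..max 0 t}"
  have S: "0 \<in> S" "t \<in> S" "convex S"
    by (auto simp: S_def)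
  have "continuous_on {min 0 t..max 0 t} f"
    using continuous_on_subset[OF cont] by blast
  then obtain G where "\<And>s. s \<in> S \<Longrightarrow> (G has_vector_derivative f s) (at s within S)"
    unfolding S_def using antiderivative_continuous by metis
  then have G: "\<And>s. s \<in> S \<Longrightarrow> (G has_real_derivative f s) (at s within S)"
    by (simp add: has_real_derivative_iff_has_vector_derivative)
  \<comment> \<open>Integrating factor: \<open>y * exp (- G)\<close> is constant, hence
    \<open>y\<close> keeps the sign of \<open>y 0\<close>.\<close>
  have "((\<lambda>s. y s * exp (- G s)) has_real_derivative 0) (at s within S)" if "s \<in> S" for s
  proof -
    have "((\<lambda>s. exp (- G s)) has_real_derivative exp (- G s) * - f s) (at s within S)"
      by (rule DERIV_chain2[OF DERIV_exp]) (rule DERIV_minus[OF G[OF that]])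
    then have "((\<lambda>s. y s * exp (- G s)) has_real_derivative
        f s * y s * exp (- G s) + exp (- G s) * - f s * y s) (at s within S)"
      by (rule DERIV_mult[OF has_field_derivative_at_within[OF deriv]])
    then show ?thesis
      by simp
  qed
  then obtain c where c: "\<And>s. s \<in> S \<Longrightarrow> y s * exp (- G s) = c"
    using has_field_derivative_zero_constant[OF S(3), of "\<lambda>s. y s * exp (- G s)"] by blast
  have "y t * exp (- G t) = y 0 * exp (- G 0)"
    using c S by simp
  also have "\<dots> > 0"
    using assms(3) by simp
  finally show ?thesis
    by (simp add: zero_less_mult_iff)
qed

text \<open>A Barbalat-type argument. \<open>V\<close> is nonincreasing; if it is bounded below, the
  total dissipation is finite. As \<open>u\<close> is Lipschitz, a late large value of
  \<open>u\<close> would persist over a window of fixed length and cost too much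
  dissipation.\<close>

lemma dissipation_dichotomy:
  fixes V V' u u' :: "real \<Rightarrow> real"
  assumes V: "\<And>t. (V has_real_derivative V' t) (at t)"
    and u: "\<And>t. (u has_real_derivative u' t) (at t)"
    and diss: "\<And>t. V' t \<le> - u t" and nonneg: "\<And>t. u t \<ge> 0"
    and bound: "\<And>t. \<bar>u' t\<bar> \<le> C"
  shows "filterlim V at_bot at_top \<or> (u \<longlongrightarrow> 0) at_top"
proof -
  have anti: "V t \<le> V s" if "s \<le> t" for s t
  proof (rule DERIV_nonpos_imp_nonincreasing[OF that])
    show "\<exists>y. (V has_real_derivative y) (at x) \<and> y \<le> 0" for x
      using V[of x] diss[of x] nonneg[of x] by (intro exI[of _ "V' x"]) auto
  qed
  show ?thesis
  proof (cases "\<exists>B. \<forall>t. B \<le> V t")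
    case False
    have "\<exists>s. \<forall>t\<ge>s. V t \<le> B" for B
      using False anti by (meson linear order_trans)
    then have "filterlim V at_bot at_top"
      by (auto simp: filterlim_at_bot eventually_at_top_linorder)
    then show ?thesis ..
  next
    case True
    then obtain B where B: "\<And>t. B \<le> V t"
      by blast
    define L where "L = (INF t. V t)"
    have bdd: "bdd_below (range V)"
      using B by (intro bdd_belowI) auto
    have L: "L \<le> V t" for t
      unfolding L_def by (intro cINF_lower bdd) simp
    have C: "C \<ge> 0"
      using bound[of 0] by linarith
    \<comment> \<open>The mean value theorem for \<open>V\<close> on \<open>[t, t + h]\<close> gives
      a point \<open>z\<close> with \<open>u z\<close> at most \<open>(V t - L) / h\<close>; going
      back from \<open>z\<close> to \<open>t\<close> changes \<open>u\<close> by at most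
      \<open>C * h\<close>.\<close>
    have step: "u t \<le> C * h + (V t - L) / h" if h: "h > 0" for t h
    proof -
      obtain z where z: "t < z" "z < t + h" "V (t + h) - V t = h * V' z"
        using MVT2[of t "t + h" V V'] V h by auto
      obtain w where w: "u z - u t = (z - t) * u' w"
        using MVT2[of t z u u'] u z by blast
      have "- C \<le> u' w"
        using bound[of w] by linarith
      then have "(z - t) * (- C) \<le> (z - t) * u' w"
        using z by (intro mult_left_mono) auto
      moreover have "(z - t) * C \<le> h * C"
        using z C by (intro mult_right_mono) auto
      ultimately have "u t \<le> C * h + u z"
        using w by (simp add: mult.commute)
      moreover have "h * V' z \<le> h * (- u z)"
        using diss[of z] h by (intro mult_left_mono) auto
      then have "h * u z \<le> V t - L"
        using z(3) L[of "t + h"] by linarith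
      then have "u z \<le> (V t - L) / h"
        using h by (simp add: field_simps)
      ultimately show ?thesis
        by linarith
    qed
    have "(u \<longlongrightarrow> 0) at_top"
    proof (rule tendstoI)
      fix e :: real assume e: "e > 0"
      \<comment> \<open>The window makes the Lipschitz error at most \<open>e / 2\<close>;
        \<open>C + 1\<close> keeps the quotient meaningful for \<open>C = 0\<close>. Then
        \<open>V\<close> within \<open>h * e / 2\<close> of its infimum makes the other term less
        than \<open>e / 2\<close>.\<close>
      define h where "h = e / (2 * (C + 1))"
      have h: "h > 0" and Ch: "C * h \<le> e / 2"
        using e C by (auto simp: h_def field_simps)
      have "L < L + h * e / 2"
        using h e by simp
      then obtain s where s: "V s < L + h * e / 2"
        using cINF_less_iff[of UNIV V "L + h * e / 2"] bdd by (auto simp: L_def)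
      have "dist (u t) 0 < e" if "s \<le> t" for t
      proof -
        have "V t - L < h * (e / 2)"
          using s anti[OF that] by simp
        then have "(V t - L) / h < e / 2"
          using h by (simp add: pos_divide_less_eq mult.commute)
        then have "u t < e"
          using step[OF h, of t] Ch by linarith
        then show ?thesis
          using nonneg[of t] by (simp add: dist_real_def)
      qed
      then show "\<forall>\<^sub>F t in at_top. dist (u t) 0 < e"
        unfolding eventually_at_top_linorder by blast
    qed
    then show ?thesis ..
  qed
qed

lemma tendsto_zero_of_power:
  fixes f :: "'a \<Rightarrow> real"
  assumes "((\<lambda>x. f x ^ n) \<longlongrightarrow> 0) F" "\<And>x. f x \<ge> 0" "n > 0"
  shows "(f \<longlongrightarrow> 0) F"
  using tendsto_real_root[OF assms(1), of n] assms(2,3) by (simp add: real_root_power_cancel)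

lemma DERIV_square:
  fixes f :: "real \<Rightarrow> real"
  assumes "(f has_real_derivative a) (at t)"
  shows "((\<lambda>t. (f t)\<^sup>2) has_real_derivative 2 * f t * a) (at t)"
  using DERIV_power[OF assms, of 2] by (simp add: mult_ac)

section \<open>Scalar equations of an orbit, positivity and bounds\<close>

locale orbit =
  fixes qs :: real and M P \<theta> Sp Sm q \<Omega> :: "real \<Rightarrow> real"
  assumes q_eq: "q t = (2 - qs) * ((1 + (sin (\<theta> t))\<^sup>2 / 3) * (Sp t)\<^sup>2 + (Sm t)\<^sup>2 + (P t)\<^sup>2)
      + qs * (1 - (1 + (sin (\<theta> t))\<^sup>2 / 3) * (M t)\<^sup>2)"
    and Omega_eq: "\<Omega> t = 1 - (1 + (sin (\<theta> t))\<^sup>2 / 3) * ((M t)\<^sup>2 + (Sp t)\<^sup>2) - (P t)\<^sup>2 - (Sm t)\<^sup>2"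
    and dM: "(M has_real_derivative (q t + 2 * Sp t + 2 * sqrt 3 * cos (\<theta> t) * Sm t) * M t) (at t)"
    and dP: "(P has_real_derivative
      (- (2 - q t) - (3 + (sin (\<theta> t))\<^sup>2) * Sp t + sqrt 3 * cos (\<theta> t) * Sm t) * P t) (at t)"
    and dth: "(\<theta> has_real_derivative - 2 * sqrt 3 * Sm t * sin (\<theta> t)) (at t)"
    and dSp: "(Sp has_real_derivative - (2 - q t) * Sp t - 2 * (M t)\<^sup>2 + 3 * (P t)\<^sup>2) (at t)"
    and dSm: "(Sm has_real_derivative - (2 - q t) * Sm t - sqrt 3 * cos (\<theta> t)
      * (2 * (M t)\<^sup>2 + (P t)\<^sup>2 - 2 / 3 * (sin (\<theta> t))\<^sup>2 * (Sp t)\<^sup>2)) (at t)"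
    and qs: "qs \<ge> 1"
    and init: "M 0 > 0" "P 0 > 0" "sin (\<theta> 0) > 0" "\<Omega> 0 > 0"
begin

lemma cont:
  "continuous_on UNIV M" "continuous_on UNIV P" "continuous_on UNIV \<theta>"
  "continuous_on UNIV Sp" "continuous_on UNIV Sm"
  by (intro continuous_at_imp_continuous_on ballI,
      rule DERIV_isCont[OF dM] DERIV_isCont[OF dP] DERIV_isCont[OF dth]
        DERIV_isCont[OF dSp] DERIV_isCont[OF dSm])+

lemma cont_q: "continuous_on UNIV q"
  unfolding q_eq[abs_def] by (intro continuous_intros cont) simp_all

lemma dsin: "((\<lambda>t. sin (\<theta> t)) has_real_derivative
    (- 2 * sqrt 3 * cos (\<theta> t) * Sm t) * sin (\<theta> t)) (at t)"
  by (rule DERIV_cong[OF DERIV_chain2[OF DERIV_sin dth]]) simp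

lemma dOmega: "(\<Omega> has_real_derivative 2 * (q t - qs) * \<Omega> t) (at t)"
proof -
  \<comment> \<open>The letters \<open>s r c m x p Q y\<close> stand for sin \<theta>,
    \<open>sqrt 3\<close>, cos \<theta>, \<open>Sm\<close>, \<open>M\<close>, \<open>Sp\<close>,
    \<open>q\<close>, \<open>P\<close>. This is a polynomial identity in free variables: all terms
    with \<open>r * c * m\<close> cancel.\<close>
  have id: "- (2 * s * ((- 2 * r * c * m) * s) / 3) * (x\<^sup>2 + p\<^sup>2)
      - (1 + s\<^sup>2 / 3) * (2 * x * ((Q + 2 * p + 2 * r * c * m) * x)
          + 2 * p * (- (2 - Q) * p - 2 * x\<^sup>2 + 3 * y\<^sup>2))
      - 2 * y * ((- (2 - Q) - (3 + s\<^sup>2) * p + r * c * m) * y)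
      - 2 * m * (- (2 - Q) * m - r * c * (2 * x\<^sup>2 + y\<^sup>2 - 2 / 3 * s\<^sup>2 * p\<^sup>2))
      = 4 * ((1 + s\<^sup>2 / 3) * p\<^sup>2 + y\<^sup>2 + m\<^sup>2)
        - 2 * Q * ((1 + s\<^sup>2 / 3) * (x\<^sup>2 + p\<^sup>2) + y\<^sup>2 + m\<^sup>2)"
    for r s c Q p m x y :: real
    by (simp add: field_simps power2_eq_square)
  have q: "4 * ((1 + (sin (\<theta> t))\<^sup>2 / 3) * (Sp t)\<^sup>2 + (P t)\<^sup>2 + (Sm t)\<^sup>2)
      = 2 * q t - 2 * qs * \<Omega> t"
    unfolding q_eq Omega_eq by (simp add: field_simps)
  have k: "(1 + (sin (\<theta> t))\<^sup>2 / 3) * ((M t)\<^sup>2 + (Sp t)\<^sup>2) + (P t)\<^sup>2 + (Sm t)\<^sup>2 = 1 - \<Omega> t"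
    unfolding Omega_eq by simp
  have "((\<lambda>t. 1 - (1 + (sin (\<theta> t))\<^sup>2 / 3) * ((M t)\<^sup>2 + (Sp t)\<^sup>2) - (P t)\<^sup>2 - (Sm t)\<^sup>2)
      has_real_derivative 4 * ((1 + (sin (\<theta> t))\<^sup>2 / 3) * (Sp t)\<^sup>2 + (P t)\<^sup>2 + (Sm t)\<^sup>2)
        - 2 * q t * ((1 + (sin (\<theta> t))\<^sup>2 / 3) * ((M t)\<^sup>2 + (Sp t)\<^sup>2) + (P t)\<^sup>2 + (Sm t)\<^sup>2)) (at t)"
    unfolding id[of "sin (\<theta> t)" "sqrt 3" "cos (\<theta> t)" "Sm t" "M t" "Sp t" "q t" "P t", symmetric]
    by (rule DERIV_cong[OF DERIV_diff[OF DERIV_diff[OF DERIV_diff[OF DERIV_const DERIV_mult[OF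
        DERIV_add[OF DERIV_const DERIV_cdivide[OF DERIV_square[OF dsin]]] DERIV_add[OF DERIV_square[OF dM] DERIV_square[OF dSp]]]]
        DERIV_square[OF dP]] DERIV_square[OF dSm]]]) (simp add: algebra_simps)
  then show ?thesis
    unfolding q k Omega_eq[abs_def, symmetric] by (simp add: algebra_simps)
qed

text \<open>Each of the four functions solves a homogeneous linear equation whose coefficient is
  continuous along the orbit.\<close>

lemma pos: "M t > 0" "P t > 0" "sin (\<theta> t) > 0" "\<Omega> t > 0"
  by (rule linear_ode_pos[OF dM] linear_ode_pos[OF dP] linear_ode_pos[OF dsin]
      linear_ode_pos[OF dOmega], intro continuous_intros cont cont_q, rule init)+

text \<open>Solving the definition of \<Omega> for 1 gives a sum of nonnegative terms, among them
  \<Omega> and the four squares.\<close>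

lemma le_one: "M t \<le> 1" "P t \<le> 1" "\<bar>Sp t\<bar> \<le> 1" "\<bar>Sm t\<bar> \<le> 1" "\<Omega> t \<le> 1"
proof -
  define k where "k = (sin (\<theta> t))\<^sup>2 / 3 * ((M t)\<^sup>2 + (Sp t)\<^sup>2)"
  have "k \<ge> 0"
    by (simp add: k_def)
  moreover have eq: "\<Omega> t + k + (M t)\<^sup>2 + (Sp t)\<^sup>2 + (P t)\<^sup>2 + (Sm t)\<^sup>2 = 1"
    by (simp add: Omega_eq k_def algebra_simps)
  moreover have "(M t)\<^sup>2 \<ge> 0" "(Sp t)\<^sup>2 \<ge> 0" "(P t)\<^sup>2 \<ge> 0" "(Sm t)\<^sup>2 \<ge> 0"
    by simp_all
  ultimately have "(M t)\<^sup>2 \<le> 1" "(P t)\<^sup>2 \<le> 1" "(Sp t)\<^sup>2 \<le> 1" "(Sm t)\<^sup>2 \<le> 1" "\<Omega> t \<le> 1"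
    using pos(4)[of t] by linarith+
  then show "M t \<le> 1" "P t \<le> 1" "\<bar>Sp t\<bar> \<le> 1" "\<bar>Sm t\<bar> \<le> 1" "\<Omega> t \<le> 1"
    by (simp_all add: abs_square_le_1 abs_le_iff)
qed

section \<open>The monotone function ln Z and its behaviour in both time directions\<close>

definition W :: "real \<Rightarrow> real" where
  "W t = 3 * ln (\<Omega> t) - 4 * ln (M t) - 2 * ln (P t) - 5 * ln (sin (\<theta> t))"

text \<open>In the weighted sum of logarithmic rates, \<open>q\<close> has coefficient 6 - 4 - 2 = 0
  and \<open>sqrt 3 * cos \<theta> * Sm\<close> has -8 - 2 + 10 = 0, while \<open>Sp\<close> keeps
  -8 + 6 + 2 sin^2 \<theta> = -2 cos^2 \<theta>.\<close>

lemma dW: "(W has_real_derivative 4 - 6 * qs - 2 * (cos (\<theta> t))\<^sup>2 * Sp t) (at t)"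
proof -
  have dln: "((\<lambda>t. ln (f t)) has_real_derivative a) (at t)"
    if "(f has_real_derivative a * f t) (at t)" "f t > 0" for f :: "real \<Rightarrow> real" and a
    using DERIV_ln_divide[THEN DERIV_chain2, OF that(2,1)] that(2) by simp
  show ?thesis
    unfolding W_def[abs_def]
    apply (rule DERIV_cong)
     apply (rule dln[OF dM] dln[OF dP] dln[OF dsin] dln[OF dOmega] pos derivative_eq_intros refl)+
    apply (simp add: cos_squared_eq algebra_simps)
    done
qed

lemma dW_le: "4 - 6 * qs - 2 * (cos (\<theta> t))\<^sup>2 * Sp t \<le> - (sin (\<theta> t))\<^sup>2"
proof -
  have "(cos (\<theta> t))\<^sup>2 * (- 1) \<le> (cos (\<theta> t))\<^sup>2 * Sp t"
    using le_one(3)[of t] by (intro mult_left_mono) auto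
  moreover have "(sin (\<theta> t))\<^sup>2 \<ge> 0" "(sin (\<theta> t))\<^sup>2 + (cos (\<theta> t))\<^sup>2 = 1"
    by simp_all
  ultimately show ?thesis
    using qs by linarith
qed

text \<open>The division-free form of Z, from which both limits are read off.\<close>

lemma exp_W: "exp (W t) * (M t ^ 4 * P t ^ 2 * sin (\<theta> t) ^ 5) = \<Omega> t ^ 3"
proof -
  have e: "exp (numeral n * ln x) = x ^ numeral n" if "x > 0" for x :: real and n
    using that by (metis exp_of_nat_mult exp_ln of_nat_numeral)
  show ?thesis
    using pos[of t] by (simp add: W_def exp_diff e)
qed

lemma dsin2: "((\<lambda>t. (sin (\<theta> t))\<^sup>2) has_real_derivative
    - 4 * sqrt 3 * cos (\<theta> t) * Sm t * (sin (\<theta> t))\<^sup>2) (at t)"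
  by (rule DERIV_cong[OF DERIV_square[OF dsin]]) (simp add: power2_eq_square)

lemma dsin2_bound: "\<bar>- 4 * sqrt 3 * cos (\<theta> t) * Sm t * (sin (\<theta> t))\<^sup>2\<bar> \<le> 4 * sqrt 3"
proof -
  have "\<bar>cos (\<theta> t)\<bar> * \<bar>Sm t\<bar> * (sin (\<theta> t))\<^sup>2 \<le> 1 * 1 * 1"
    using le_one(4) by (intro mult_mono) (auto simp: abs_square_le_1)
  then show ?thesis
    by (simp add: abs_mult mult.assoc)
qed

lemma W_forward: "filterlim W at_bot at_top \<or> ((\<lambda>t. (sin (\<theta> t))\<^sup>2) \<longlongrightarrow> 0) at_top"
  by (rule dissipation_dichotomy) (rule dW dsin2 dW_le zero_le_power2 dsin2_bound)+

lemma W_backward: "filterlim W at_top at_bot \<or> ((\<lambda>t. (sin (\<theta> t))\<^sup>2) \<longlongrightarrow> 0) at_bot"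
proof -
  \<comment> \<open>Time reversal: \<open>- W (- t)\<close> has derivative \<open>W'\<close> at
    \<open>- t\<close>, so it dissipates in the same way.\<close>
  have "filterlim (\<lambda>t. - W (- t)) at_bot at_top
      \<or> ((\<lambda>t. (sin (\<theta> (- t)))\<^sup>2) \<longlongrightarrow> 0) at_top"
  proof (rule dissipation_dichotomy)
    show "((\<lambda>t. - W (- t)) has_real_derivative
        4 - 6 * qs - 2 * (cos (\<theta> (- t)))\<^sup>2 * Sp (- t)) (at t)" for t
      using DERIV_minus[OF DERIV_mirror[THEN iffD1, OF dW]] by (simp only: minus_minus)
    show "((\<lambda>t. (sin (\<theta> (- t)))\<^sup>2) has_real_derivative
        - (- 4 * sqrt 3 * cos (\<theta> (- t)) * Sm (- t) * (sin (\<theta> (- t)))\<^sup>2)) (at t)" for t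
      by (rule DERIV_mirror[THEN iffD1, OF dsin2])
    show "\<bar>- (- 4 * sqrt 3 * cos (\<theta> (- t)) * Sm (- t) * (sin (\<theta> (- t)))\<^sup>2)\<bar> \<le> 4 * sqrt 3" for t
      using dsin2_bound[of "- t"] by simp
  qed (simp_all only: dW_le zero_le_power2)
  then show ?thesis
    by (simp only: filterlim_at_bot_mirror filterlim_uminus_at_top)
qed

lemma W_anti:
  assumes "s \<le> t"
  shows "W t \<le> W s"
proof (rule DERIV_nonpos_imp_nonincreasing[OF assms])
  show "\<exists>y. (W has_real_derivative y) (at x) \<and> y \<le> 0" for x
    using dW[of x] order_trans[OF dW_le[of x], of 0] by auto
qed

section \<open>The two limits\<close>

lemma MPsin_le_one: "M t ^ 4 * P t ^ 2 * sin (\<theta> t) ^ 5 \<le> 1"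
  using pos[of t] le_one[of t] by (intro mult_le_one power_le_one) auto

text \<open>Two of the five sine factors are kept, and all other factors are bounded by 1. This
  serves the alternative in which sin \<theta> tends to 0.\<close>

lemma MPsin_le_sin2: "M t ^ 4 * P t ^ 2 * sin (\<theta> t) ^ 5 \<le> (sin (\<theta> t))\<^sup>2"
proof -
  have "M t ^ 4 * P t ^ 2 * sin (\<theta> t) ^ 5 \<le> 1 * (sin (\<theta> t))\<^sup>2"
    using pos[of t] le_one[of t]
    by (intro mult_mono mult_le_one power_le_one power_decreasing) auto
  then show ?thesis
    by simp
qed

lemma Omega_tendsto: "(\<Omega> \<longlongrightarrow> 0) at_top"
proof (rule tendsto_zero_of_power)
  show "((\<lambda>t. \<Omega> t ^ 3) \<longlongrightarrow> 0) at_top"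
    using W_forward
  proof
    assume "filterlim W at_bot at_top"
    then have "((\<lambda>t. exp (W t)) \<longlongrightarrow> 0) at_top"
      by (rule filterlim_compose[OF exp_at_bot])
    then show ?thesis
    proof (rule tendsto_0_le[where K = 1], intro always_eventually allI)
      show "norm (\<Omega> t ^ 3) \<le> norm (exp (W t)) * 1" for t
        using mult_left_mono[OF MPsin_le_one[of t], of "exp (W t)"] exp_W[of t] pos(4)[of t] by simp
    qed
  next
    assume "((\<lambda>t. (sin (\<theta> t))\<^sup>2) \<longlongrightarrow> 0) at_top"
    then show ?thesis
    proof (rule tendsto_0_le[where K = "exp (W 0)"], intro eventually_at_top_linorderI[of 0])
      \<comment> \<open>Here \<open>W\<close> need not tend to minus infinity, but monotonicity
        bounds it by \<open>W 0\<close> for nonnegative times.\<close>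
      fix t :: real assume "0 \<le> t"
      then have "exp (W t) * (M t ^ 4 * P t ^ 2 * sin (\<theta> t) ^ 5) \<le> exp (W 0) * (sin (\<theta> t))\<^sup>2"
        using pos[of t] W_anti by (intro mult_mono MPsin_le_sin2) auto
      then show "norm (\<Omega> t ^ 3) \<le> norm ((sin (\<theta> t))\<^sup>2) * exp (W 0)"
        using exp_W[of t] pos(4)[of t] by (simp add: mult.commute)
    qed
  qed
qed (use pos in \<open>auto intro: less_imp_le\<close>)

lemma MPsin_tendsto: "((\<lambda>t. M t * P t * sin (\<theta> t)) \<longlongrightarrow> 0) at_bot"
proof (rule tendsto_zero_of_power)
  \<comment> \<open>The fifth power is chosen because 5 is the largest exponent in the denominator
    of Z and the factors lie in (0, 1].\<close>
  have le: "(M t * P t * sin (\<theta> t)) ^ 5 \<le> M t ^ 4 * P t ^ 2 * sin (\<theta> t) ^ 5" for t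
    unfolding power_mult_distrib
    using pos[of t] le_one[of t] by (intro mult_mono power_decreasing) auto
  show "((\<lambda>t. (M t * P t * sin (\<theta> t)) ^ 5) \<longlongrightarrow> 0) at_bot"
    using W_backward
  proof
    assume "filterlim W at_top at_bot"
    then have "((\<lambda>t. exp (- W t)) \<longlongrightarrow> 0) at_bot"
      by (intro filterlim_compose[OF exp_at_bot]) (simp add: filterlim_uminus_at_bot)
    then show ?thesis
    proof (rule tendsto_0_le[where K = 1], intro always_eventually allI)
      fix t
      \<comment> \<open>With the numerator of Z at most 1, the denominator is at most 1/Z, which
        tends to 0.\<close>
      have "\<Omega> t ^ 3 \<le> 1"
        using pos(4)[of t] le_one(5)[of t] by (intro power_le_one) auto
      then have "M t ^ 4 * P t ^ 2 * sin (\<theta> t) ^ 5 \<le> exp (- W t)"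
        using exp_W[of t] by (simp add: exp_minus field_simps)
      then show "norm ((M t * P t * sin (\<theta> t)) ^ 5) \<le> norm (exp (- W t)) * 1"
        using le[of t] pos[of t] by simp
    qed
  next
    assume "((\<lambda>t. (sin (\<theta> t))\<^sup>2) \<longlongrightarrow> 0) at_bot"
    then show ?thesis
    proof (rule tendsto_0_le[where K = 1], intro always_eventually allI)
      show "norm ((M t * P t * sin (\<theta> t)) ^ 5) \<le> norm ((sin (\<theta> t))\<^sup>2) * 1" for t
        using le[of t] MPsin_le_sin2[of t] pos[of t] by simp
    qed
  qed
qed (use pos in \<open>auto intro!: mult_nonneg_nonneg less_imp_le\<close>)

end

section \<open>Transfer to flow lines\<close>

theorem proposition7p1:
  fixes \<gamma> :: real and x :: state and X :: "real \<Rightarrow> state"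
  assumes "\<gamma> \<in> {4/3..2}"
    and "x \<in> B_plus_Omega - OT_plus_Omega"
    and "flow_line \<gamma> x X"
  shows "((\<lambda>\<tau>. M_of (X \<tau>) * P_of (X \<tau>) * sin (theta_of (X \<tau>))) \<longlongrightarrow> 0) at_bot
       \<and> ((\<lambda>\<tau>. Omega (X \<tau>)) \<longlongrightarrow> 0) at_top"
proof -
  define Sp where "Sp = (\<lambda>t. fst (snd (snd (snd (X t)))))"
  define Sm where "Sm = (\<lambda>t. snd (snd (snd (snd (X t)))))"
  have X0: "X 0 = x" and d: "\<And>t. (X has_vector_derivative vector_field \<gamma> (X t)) (at t)"
    using assms(3) by (auto simp: flow_line_def)
  have fst: "((\<lambda>t. fst (f t)) has_vector_derivative fst D) F"
    if "(f has_vector_derivative D) F" for f :: "real \<Rightarrow> 'b::real_normed_vector \<times> 'c::real_normed_vector" and D F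
    by (rule bounded_linear.has_vector_derivative[OF bounded_linear_fst that])
  have snd: "((\<lambda>t. snd (f t)) has_vector_derivative snd D) F"
    if "(f has_vector_derivative D) F" for f :: "real \<Rightarrow> 'b::real_normed_vector \<times> 'c::real_normed_vector" and D F
    by (rule bounded_linear.has_vector_derivative[OF bounded_linear_snd that])
  note comps = d[THEN fst] d[THEN snd, THEN fst] d[THEN snd, THEN snd, THEN fst]
    d[THEN snd, THEN snd, THEN snd, THEN fst] d[THEN snd, THEN snd, THEN snd, THEN snd]
  have proj: "M_of = fst" "P_of = (\<lambda>x. fst (snd x))" "theta_of = (\<lambda>x. fst (snd (snd x)))"
    by (auto simp: M_of_def P_of_def theta_of_def)
  interpret orbit "qstar \<gamma>" "\<lambda>t. M_of (X t)" "\<lambda>t. P_of (X t)" "\<lambda>t. theta_of (X t)" Sp Sm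
    "\<lambda>t. decel \<gamma> (X t)" "\<lambda>t. Omega (X t)"
  proof
    show "qstar \<gamma> \<ge> 1"
      using assms(1) by (simp add: qstar_def)
    \<comment> \<open>Excluding \<open>OT_plus_Omega\<close> turns \<open>P \<ge> 0\<close> into
      strict positivity; \<theta> in (0, \<pi>) gives a positive sine.\<close>
    show "M_of (X 0) > 0" "P_of (X 0) > 0" "sin (theta_of (X 0)) > 0" "Omega (X 0) > 0"
      using assms(2) by (auto simp: X0 B_plus_Omega_def OT_plus_Omega_def B_plus_def intro!: sin_gt_zero)
  qed (use comps in \<open>simp_all add: has_real_derivative_iff_has_vector_derivative proj Sp_def Sm_def
      decel_def Omega_def vector_field_def Let_def case_prod_beta\<close>)
  show ?thesis
    using MPsin_tendsto Omega_tendsto by blast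
qed

end
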